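(* For every $\delta>0$ there is $n_0$ such that for every $n\ge n_0$ and every $n$-vertex 2-factor $F$, every red/blue-coloring of $E(K_n)$ contains a copy of $F$ with at least $(2/3-\delta)n$ edges of the same color.
   Context: A 2-factor on $n$ vertices is a 2-regular graph on $n$ vertices (a vertex-disjoint union of cycles covering all vertices). A copy of $F$ in $K_n$ is a subgraph of $K_n$ isomorphic to $F$. *)

theory Defs
  imports Complex_Main
begin

text \<open>Graphs on the vertex set {0..<n} are represented by their edge sets:
  sets of 2-element subsets of {..<n}. The complete graph K_n has all
  2-element subsets as edges.\<close>

definition edges_Kn :: "nat \<Rightarrow> nat set set" where
  "edges_Kn n = {e. e \<subseteq> {..<n} \<and> card e = 2}"

definition two_factor :: "nat \<Rightarrow> nat set set \<Rightarrow> bool" where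
  "two_factor n F \<longleftrightarrow> F \<subseteq> edges_Kn n \<and> (\<forall>v<n. card {e\<in>F. v \<in> e} = 2)"

text \<open>H is a copy of F in K_n: a subgraph of K_n isomorphic to F (as F spans
  all n vertices, this is the image of F under a permutation of the vertices).\<close>
definition is_copy :: "nat \<Rightarrow> nat set set \<Rightarrow> nat set set \<Rightarrow> bool" where
  "is_copy n F H \<longleftrightarrow> (\<exists>\<sigma>. bij_betw \<sigma> {..<n} {..<n} \<and> H = (\<lambda>e. \<sigma> ` e) ` F)"

end

theory Submission
  imports Defs "HOL-Library.Ramsey"
begin

text \<open>A graph of maximum degree at most 2 has, for every size, a vertex set of that size cut by at
  most two edges, so it can be embedded piecewise into disjoint parts of \<open>K\<^sub>n\<close> of bounded size at a
  negligible loss. By Ramsey's theorem almost all vertices lie in large monochromatic cliques.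
  If the red or the blue cliques cover at least \<open>2n/3\<close> vertices, filling them suffices.
  Otherwise almost all of \<open>K\<^sub>n\<close> decomposes into chunks consisting of a clique \<open>X\<close> of one colour with
  \<open>2t\<close> vertices and a clique \<open>Y\<close> of the other colour with \<open>t\<close> vertices, all edges in between having
  the same colour. A third of the vertices of any piece can be chosen independent; placing them
  in \<open>Y\<close> gives \<open>3t\<close> edges in the colour of \<open>X\<close> or \<open>2t\<close> in that of \<open>Y\<close>, according to the colour in
  between, while filling \<open>Y\<close> or \<open>X\<close> alone gives \<open>t\<close> or \<open>2t\<close> edges in the respective other colour.
  Either way the best red and the best blue embedding have about \<open>4t\<close> edges together, hence
  \<open>4n/3\<close> in total, and the better one has \<open>2n/3\<close>.\<close>

section \<open>Graphs of maximum degree at most two: small cuts and independent sets\<close>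

text \<open>Degrees are bounded by 2 rather than equal to 2 so that the class is closed under
  passing to vertex subsets, as happens when a 2-factor is cut into pieces.\<close>

definition deg2_graph :: "nat set \<Rightarrow> nat set set \<Rightarrow> bool" where
  "deg2_graph S E \<longleftrightarrow> finite S \<and> E \<subseteq> {e. e \<subseteq> S \<and> card e = 2} \<and>
     (\<forall>v\<in>S. card {e\<in>E. v \<in> e} \<le> 2)"

lemma deg2_graph_finite:
  assumes "deg2_graph S E"
  shows "finite S" "finite E"
proof -
  show "finite S" using assms by (simp add: deg2_graph_def)
  then have "finite (Pow S)" by simp
  moreover have "E \<subseteq> Pow S" using assms by (auto simp: deg2_graph_def)
  ultimately show "finite E" by (rule rev_finite_subset)
qed

lemma deg2_graph_edge:
  assumes "deg2_graph S E" "e \<in> E"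
  shows "e \<subseteq> S" "card e = 2" "e \<noteq> {}"
  using assms by (auto simp: deg2_graph_def)

lemma deg2_graph_restrict:
  assumes "deg2_graph S E" "S1 \<subseteq> S"
  shows "deg2_graph S1 {e\<in>E. e \<subseteq> S1}"
proof -
  have "card {e \<in> {e \<in> E. e \<subseteq> S1}. v \<in> e} \<le> 2" if "v \<in> S1" for v
  proof -
    have "card {e \<in> {e \<in> E. e \<subseteq> S1}. v \<in> e} \<le> card {e\<in>E. v \<in> e}"
      using deg2_graph_finite[OF assms(1)] by (intro card_mono) auto
    also have "\<dots> \<le> 2" using assms that by (auto simp: deg2_graph_def)
    finally show ?thesis .
  qed
  then show ?thesis
    using assms finite_subset[OF assms(2)] by (auto simp: deg2_graph_def)
qed

lemma sum_degrees:
  fixes S :: "'a set"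
  assumes "finite S" "finite E" "\<And>e. e \<in> E \<Longrightarrow> e \<subseteq> S \<and> card e = 2"
  shows "(\<Sum>v\<in>S. card {e\<in>E. v \<in> e}) = 2 * card E"
proof (rule sum_multicount[OF assms(1,2)])
  have "{v \<in> S. v \<in> e} = e" if "e \<in> E" for e using assms(3)[OF that] by auto
  then show "\<forall>e\<in>E. card {v \<in> S. v \<in> e} = 2" using assms(3) by simp
qed

lemma deg2_graph_sum_degrees:
  assumes "deg2_graph S E"
  shows "(\<Sum>v\<in>S. card {e\<in>E. v \<in> e}) = 2 * card E"
  using deg2_graph_finite[OF assms] deg2_graph_edge[OF assms] by (intro sum_degrees) auto

lemma deg2_graph_card_edges:
  assumes "deg2_graph S E"
  shows "card E \<le> card S"
proof -
  have "(\<Sum>v\<in>S. card {e\<in>E. v \<in> e}) \<le> (\<Sum>v\<in>S. 2)"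
    using assms by (intro sum_mono) (auto simp: deg2_graph_def)
  then show ?thesis using deg2_graph_sum_degrees[OF assms] by simp
qed

text \<open>The set grows vertex by vertex along a cut edge, so that the components are swallowed
  one after another: the edge followed stops being cut and at most one new edge replaces it.\<close>

lemma deg2_graph_small_cut:
  assumes "deg2_graph S E" "m \<le> card S"
  shows "\<exists>T\<subseteq>S. card T = m \<and> card {e\<in>E. e \<inter> T \<noteq> {} \<and> \<not> e \<subseteq> T} \<le> 2"
  using assms(2)
proof (induction m)
  case 0
  show ?case by (intro exI[of _ "{}"]) auto
next
  case (Suc m)
  note fin = deg2_graph_finite[OF assms(1)]
  from Suc obtain T where T: "T \<subseteq> S" "card T = m"
    and cut: "card {e\<in>E. e \<inter> T \<noteq> {} \<and> \<not> e \<subseteq> T} \<le> 2" by auto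
  define C where "C T = {e\<in>E. e \<inter> T \<noteq> {} \<and> \<not> e \<subseteq> T}" for T
  have finT: "finite T" using T fin finite_subset by blast
  have finC: "finite (C T)" for T unfolding C_def using fin by auto
  have sub: "C (insert v T) \<subseteq> C T \<union> {e\<in>E. v \<in> e}" for v unfolding C_def by auto
  have deg: "card {e\<in>E. v \<in> e} \<le> 2" if "v \<in> S" for v using assms(1) that by (auto simp: deg2_graph_def)
  have "\<exists>v\<in>S - T. card (C (insert v T)) \<le> 2"
  proof (cases "C T = {}")
    case True
    \<comment> \<open>No edge leaves \<open>T\<close>, so any outside vertex will do: it cuts at
      most its own two edges.\<close>
    have "T \<noteq> S" using T Suc.prems by auto
    then obtain v where v: "v \<in> S - T" using T by auto
    have "card (C (insert v T)) \<le> card {e\<in>E. v \<in> e}"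
      using sub[of v] True fin by (intro card_mono) auto
    also have "\<dots> \<le> 2" using deg v by auto
    finally show ?thesis using v by blast
  next
    case False
    then obtain e0 where e0: "e0 \<in> C T" by auto
    then obtain v where v: "v \<in> e0" "v \<notin> T" by (auto simp: C_def)
    have e0E: "e0 \<in> E" using e0 by (auto simp: C_def)
    have vS: "v \<in> S" using deg2_graph_edge[OF assms(1) e0E] v by auto
    obtain u where u: "u \<in> e0" "u \<in> T" using e0 by (auto simp: C_def)
    have "e0 = {u, v}"
      using deg2_graph_edge[OF assms(1) e0E] u v by (auto simp: card_2_iff)
    \<comment> \<open>\<open>e0\<close> is now inside the set. It is also one of the at most two
      edges at \<open>v\<close>, so one old and one new cut edge can remain.\<close>
    then have "C (insert v T) \<subseteq> (C T - {e0}) \<union> ({e\<in>E. v \<in> e} - {e0})"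
      using sub[of v] u by (auto simp: C_def)
    then have "card (C (insert v T)) \<le> card ((C T - {e0}) \<union> ({e\<in>E. v \<in> e} - {e0}))"
      using finC fin by (intro card_mono) auto
    also have "\<dots> \<le> card (C T - {e0}) + card ({e\<in>E. v \<in> e} - {e0})" by (rule card_Un_le)
    also have "\<dots> \<le> 1 + 1"
      using cut deg[OF vS] e0 e0E v finC[of T] fin unfolding C_def[symmetric]
      by (intro add_mono) (auto simp: card_Diff_singleton)
    finally have "card (C (insert v T)) \<le> 2" by simp
    then show ?thesis using v vS by blast
  qed
  then obtain v where v: "v \<in> S - T" "card (C (insert v T)) \<le> 2" by auto
  then show ?case using T finT unfolding C_def
    by (intro exI[of _ "insert v T"]) auto
qed

text \<open>Greedy choice: each chosen vertex blocks only itself and its at most two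
  neighbours.\<close>

lemma deg2_graph_independent:
  assumes "deg2_graph S E" "3 * t \<le> card S"
  shows "\<exists>I\<subseteq>S. card I = t \<and> (\<forall>e\<in>E. \<not> e \<subseteq> I)"
  using assms(2)
proof (induction t)
  case 0
  show ?case using deg2_graph_edge[OF assms(1)] by (intro exI[of _ "{}"]) auto
next
  case (Suc t)
  note fin = deg2_graph_finite[OF assms(1)]
  from Suc obtain I where I: "I \<subseteq> S" "card I = t" "\<forall>e\<in>E. \<not> e \<subseteq> I" by auto
  have finI: "finite I" using I fin finite_subset by blast
  \<comment> \<open>The closed neighbourhood of \<open>v\<close>.\<close>
  define N where "N v = insert v (\<Union>e\<in>{e\<in>E. v \<in> e}. e - {v})" for v
  have "card (N v) \<le> 3" if "v \<in> I" for v
  proof -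
    have "card (\<Union>e\<in>{e\<in>E. v \<in> e}. e - {v}) \<le> (\<Sum>e\<in>{e\<in>E. v \<in> e}. card (e - {v}))"
      using fin by (intro card_UN_le) auto
    also have "\<dots> = (\<Sum>e\<in>{e\<in>E. v \<in> e}. 1)"
      using deg2_graph_edge[OF assms(1)] by (intro sum.cong) auto
    also have "\<dots> \<le> 2" using assms(1) that I by (auto simp: deg2_graph_def)
    finally show ?thesis unfolding N_def
      by (intro order.trans[OF card_insert_le_m1]) auto
  qed
  then have "card (\<Union>v\<in>I. N v) \<le> (\<Sum>v\<in>I. 3)"
    using finI by (intro order.trans[OF card_UN_le] sum_mono) auto
  also have "\<dots> < card S" using I Suc.prems by auto
  finally have less: "card (\<Union>v\<in>I. N v) < card S" .
  have finN: "finite (\<Union>v\<in>I. N v)"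
  proof -
    have "(\<Union>v\<in>I. N v) \<subseteq> S" using I deg2_graph_edge[OF assms(1)] unfolding N_def by auto
    then show ?thesis using fin finite_subset by blast
  qed
  obtain w where w: "w \<in> S" "w \<notin> (\<Union>v\<in>I. N v)"
    using less finN card_mono[of "\<Union>v\<in>I. N v" S] by fastforce
  have "\<not> e \<subseteq> insert w I" if e: "e \<in> E" for e
  proof
    assume sub: "e \<subseteq> insert w I"
    have "w \<in> e" using sub I(3) e by blast
    moreover have "e \<noteq> {w}" using deg2_graph_edge[OF assms(1) e] by auto
    ultimately obtain v where v: "v \<in> e" "v \<noteq> w" "v \<in> I" using sub by auto
    then have "w \<in> N v" using e \<open>w \<in> e\<close> unfolding N_def by auto
    then show False using w v by auto
  qed
  moreover have "w \<notin> I" using w unfolding N_def by auto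
  ultimately show ?case using I w finI by (intro exI[of _ "insert w I"]) auto
qed

section \<open>Gadgets: guaranteed numbers of edges in one colour\<close>

text \<open>The term \<open>2 |S| - 2 |E|\<close> is the total degree deficit of the graph; charging it makes the
  notion additive over disjoint sets up to a constant.\<close>
definition gadget :: "(nat set \<Rightarrow> bool) \<Rightarrow> bool \<Rightarrow> nat set \<Rightarrow> real \<Rightarrow> bool" where
  "gadget c b X \<tau> \<longleftrightarrow> finite X \<and> (\<forall>S E. deg2_graph S E \<and> card S = card X \<longrightarrow>
     (\<exists>\<sigma>. bij_betw \<sigma> S X \<and>
        real (card {e\<in>E. c (\<sigma> ` e) = b}) \<ge> \<tau> - (2 * real (card S) - 2 * real (card E))))"

lemma gadget_embed:
  assumes "gadget c b X \<tau>" "deg2_graph S E" "card S = card X"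
  obtains \<sigma> where "bij_betw \<sigma> S X"
    "real (card {e\<in>E. c (\<sigma> ` e) = b}) \<ge> \<tau> - (2 * real (card S) - 2 * real (card E))"
  using assms unfolding gadget_def by blast

lemma gadget_mono:
  assumes "gadget c b X \<tau>" "\<tau>' \<le> \<tau>"
  shows "gadget c b X \<tau>'"
  using assms unfolding gadget_def by (meson diff_right_mono order.trans)

lemma gadget_0:
  assumes "finite X"
  shows "gadget c b X 0"
  unfolding gadget_def
proof (intro conjI allI impI)
  fix S :: "nat set" and E assume A: "deg2_graph S E \<and> card S = card X"
  then obtain \<sigma> where "bij_betw \<sigma> S X"
    using assms deg2_graph_finite finite_same_card_bij by blast
  moreover have "card E \<le> card S" using A deg2_graph_card_edges by blast
  ultimately show "\<exists>\<sigma>. bij_betw \<sigma> S X \<and>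
        real (card {e\<in>E. c (\<sigma> ` e) = b}) \<ge> 0 - (2 * real (card S) - 2 * real (card E))"
    by (intro exI[of _ \<sigma>]) (auto intro: order.trans[of _ 0])
qed (rule assms)

text \<open>A small cut of the guest graph gives one part to \<open>X\<close> and the other to
  \<open>Y\<close>. At most two edges are lost, and each raises the total deficit of the two parts
  by 2, hence the loss of 4.\<close>

lemma gadget_Un:
  assumes "gadget c b X \<tau>" "gadget c b Y \<upsilon>" "X \<inter> Y = {}"
  shows "gadget c b (X \<union> Y) (\<tau> + \<upsilon> - 4)"
  unfolding gadget_def
proof (intro conjI allI impI)
  have finXY: "finite X" "finite Y" using assms by (auto simp: gadget_def)
  then show "finite (X \<union> Y)" by simp
  fix S :: "nat set" and E assume A: "deg2_graph S E \<and> card S = card (X \<union> Y)"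
  then have G: "deg2_graph S E" by simp
  note fin = deg2_graph_finite[OF G]
  have cS: "card S = card X + card Y" using A finXY assms(3) by (simp add: card_Un_disjoint)
  obtain T where T: "T \<subseteq> S" "card T = card X"
    and cut: "card {e\<in>E. e \<inter> T \<noteq> {} \<and> \<not> e \<subseteq> T} \<le> 2"
    using deg2_graph_small_cut[OF G, of "card X"] cS by auto
  define U where "U = S - T"
  have finT: "finite T" using T fin finite_subset by blast
  have cU: "card U = card Y" unfolding U_def using T cS finT by (simp add: card_Diff_subset)
  define ET EU where "ET = {e\<in>E. e \<subseteq> T}" and "EU = {e\<in>E. e \<subseteq> U}"
  have GT: "deg2_graph T ET" unfolding ET_def by (rule deg2_graph_restrict[OF G T(1)])
  have GU: "deg2_graph U EU" unfolding EU_def by (rule deg2_graph_restrict[OF G]) (auto simp: U_def)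
  have "E \<subseteq> ET \<union> EU \<union> {e\<in>E. e \<inter> T \<noteq> {} \<and> \<not> e \<subseteq> T}"
    unfolding ET_def EU_def U_def using deg2_graph_edge[OF G] by auto
  then have "card E \<le> card (ET \<union> EU \<union> {e\<in>E. e \<inter> T \<noteq> {} \<and> \<not> e \<subseteq> T})"
    using fin unfolding ET_def EU_def by (intro card_mono) auto
  also have "\<dots> \<le> card ET + card EU + 2"
    by (intro order.trans[OF card_Un_le] add_mono card_Un_le cut)
  finally have cE: "card E \<le> card ET + card EU + 2" .
  obtain \<sigma> where \<sigma>: "bij_betw \<sigma> T X"
    "real (card {e\<in>ET. c (\<sigma> ` e) = b}) \<ge> \<tau> - (2 * real (card T) - 2 * real (card ET))"
    using gadget_embed[OF assms(1) GT T(2)] .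
  obtain \<rho> where \<rho>: "bij_betw \<rho> U Y"
    "real (card {e\<in>EU. c (\<rho> ` e) = b}) \<ge> \<upsilon> - (2 * real (card U) - 2 * real (card EU))"
    using gadget_embed[OF assms(2) GU cU] .
  define \<pi> where "\<pi> x = (if x \<in> T then \<sigma> x else \<rho> x)" for x
  have \<pi>T: "\<pi> x = \<sigma> x" if "x \<in> T" for x using that by (simp add: \<pi>_def)
  have \<pi>U: "\<pi> x = \<rho> x" if "x \<in> U" for x using that by (simp add: \<pi>_def U_def)
  have "bij_betw \<pi> T X" using \<sigma>(1) bij_betw_cong[of T \<pi> \<sigma> X] \<pi>T by blast
  moreover have "bij_betw \<pi> U Y" using \<rho>(1) bij_betw_cong[of U \<pi> \<rho> Y] \<pi>U by blast
  ultimately have "bij_betw \<pi> (T \<union> U) (X \<union> Y)" using assms(3) by (rule bij_betw_combine)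
  moreover have "T \<union> U = S" unfolding U_def using T by auto
  ultimately have bij: "bij_betw \<pi> S (X \<union> Y)" by simp
  have imT: "\<pi> ` e = \<sigma> ` e" if "e \<in> ET" for e
    using that \<pi>T unfolding ET_def by (intro image_cong) auto
  have imU: "\<pi> ` e = \<rho> ` e" if "e \<in> EU" for e
    using that \<pi>U unfolding EU_def by (intro image_cong) auto
  have disj: "ET \<inter> EU = {}"
    unfolding ET_def EU_def U_def using deg2_graph_edge[OF G] by fastforce
  have "card {e\<in>ET. c (\<sigma> ` e) = b} + card {e\<in>EU. c (\<rho> ` e) = b}
      = card ({e\<in>ET. c (\<sigma> ` e) = b} \<union> {e\<in>EU. c (\<rho> ` e) = b})"
    using disj fin unfolding ET_def EU_def by (intro card_Un_disjoint[symmetric]) auto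
  also have "\<dots> \<le> card {e\<in>E. c (\<pi> ` e) = b}"
    using fin imT imU by (intro card_mono) (auto simp: ET_def EU_def)
  finally have "real (card {e\<in>ET. c (\<sigma> ` e) = b}) + real (card {e\<in>EU. c (\<rho> ` e) = b})
      \<le> real (card {e\<in>E. c (\<pi> ` e) = b})" by linarith
  then have "real (card {e\<in>E. c (\<pi> ` e) = b})
      \<ge> \<tau> + \<upsilon> - 4 - (2 * real (card S) - 2 * real (card E))"
    using \<sigma>(2) \<rho>(2) cE cS cU T(2) by linarith
  then show "\<exists>\<pi>. bij_betw \<pi> S (X \<union> Y) \<and> real (card {e\<in>E. c (\<pi> ` e) = b})
      \<ge> \<tau> + \<upsilon> - 4 - (2 * real (card S) - 2 * real (card E))"
    using bij by (intro exI[of _ \<pi>] conjI)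
qed

section \<open>Gadgets from monochromatic cliques and monochromatic bipartite pairs\<close>

definition mono_clique :: "(nat set \<Rightarrow> bool) \<Rightarrow> bool \<Rightarrow> nat set \<Rightarrow> bool" where
  "mono_clique c b X \<longleftrightarrow> finite X \<and> (\<forall>x\<in>X. \<forall>y\<in>X. x \<noteq> y \<longrightarrow> c {x, y} = b)"

lemma mono_clique_subset: "mono_clique c b X \<Longrightarrow> Y \<subseteq> X \<Longrightarrow> mono_clique c b Y"
  unfolding mono_clique_def using finite_subset by blast

lemma gadget_mono_clique:
  assumes "mono_clique c b X"
  shows "gadget c b X (card X)"
  unfolding gadget_def
proof (intro conjI allI impI)
  show finX: "finite X" using assms by (simp add: mono_clique_def)
  fix S :: "nat set" and E assume A: "deg2_graph S E \<and> card S = card X"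
  then have G: "deg2_graph S E" by simp
  obtain \<sigma> where \<sigma>: "bij_betw \<sigma> S X"
    using A finX deg2_graph_finite finite_same_card_bij by blast
  have "c (\<sigma> ` e) = b" if e: "e \<in> E" for e
  proof -
    obtain u v where uv: "e = {u, v}" "u \<noteq> v"
      using deg2_graph_edge[OF G e] by (auto simp: card_2_iff)
    have "u \<in> S" "v \<in> S" using deg2_graph_edge[OF G e] uv by auto
    then have "\<sigma> u \<in> X" "\<sigma> v \<in> X" "\<sigma> u \<noteq> \<sigma> v"
      using \<sigma> uv by (auto simp: bij_betw_def inj_on_def)
    then show ?thesis using assms uv by (auto simp: mono_clique_def)
  qed
  then have "{e\<in>E. c (\<sigma> ` e) = b} = E" by auto
  \<comment> \<open>All edges have colour \<open>b\<close>, and the required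
    \<open>card E \<ge> card S - 2 * (card S - card E)\<close> is the same inequality.\<close>
  moreover have "card E \<le> card S" using G deg2_graph_card_edges by blast
  ultimately show "\<exists>\<sigma>. bij_betw \<sigma> S X \<and> real (card {e\<in>E. c (\<sigma> ` e) = b})
      \<ge> real (card X) - (2 * real (card S) - 2 * real (card E))"
    using \<sigma> A by (intro exI[of _ \<sigma>]) auto
qed

definition mono_cross :: "(nat set \<Rightarrow> bool) \<Rightarrow> bool \<Rightarrow> nat set \<Rightarrow> nat set \<Rightarrow> bool" where
  "mono_cross c b X Y \<longleftrightarrow> (\<forall>x\<in>X. \<forall>y\<in>Y. c {x, y} = b)"

lemma independent_placement:
  assumes "deg2_graph S E" "card S = 3 * t" "finite X" "finite Y" "X \<inter> Y = {}"
    "card X = 2 * t" "card Y = t"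
  obtains \<sigma> I where "bij_betw \<sigma> S (X \<union> Y)" "I \<subseteq> S" "card I = t" "\<forall>e\<in>E. \<not> e \<subseteq> I"
    "\<sigma> ` I \<subseteq> Y" "\<sigma> ` (S - I) \<subseteq> X"
proof -
  note fin = deg2_graph_finite[OF assms(1)]
  obtain I where I: "I \<subseteq> S" "card I = t" "\<forall>e\<in>E. \<not> e \<subseteq> I"
    using deg2_graph_independent[OF assms(1), of t] assms(2) by auto
  have finI: "finite I" using I fin finite_subset by blast
  obtain \<sigma> where \<sigma>: "bij_betw \<sigma> I Y"
    using finite_same_card_bij[OF finI assms(4)] I assms by auto
  have "card (S - I) = card X" using I finI assms by (simp add: card_Diff_subset)
  then obtain \<rho> where \<rho>: "bij_betw \<rho> (S - I) X"
    using finite_same_card_bij[of "S - I" X] fin assms by auto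
  define \<pi> where "\<pi> x = (if x \<in> I then \<sigma> x else \<rho> x)" for x
  have 1: "bij_betw \<pi> I Y"
    using \<sigma> by (subst bij_betw_cong[of I \<pi> \<sigma>]) (auto simp: \<pi>_def)
  have 2: "bij_betw \<pi> (S - I) X"
    using \<rho> by (subst bij_betw_cong[of "S - I" \<pi> \<rho>]) (auto simp: \<pi>_def)
  have "bij_betw \<pi> ((S - I) \<union> I) (X \<union> Y)" using 2 1 assms(5) by (rule bij_betw_combine)
  moreover have "(S - I) \<union> I = S" using I by auto
  ultimately have "bij_betw \<pi> S (X \<union> Y)" by simp
  moreover have "\<pi> ` I \<subseteq> Y" "\<pi> ` (S - I) \<subseteq> X" using 1 2 by (auto simp: bij_betw_def)
  ultimately show ?thesis using I that by blast
qed

text \<open>With an independent third of the vertices placed in \<open>Y\<close>, no edge lies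
  inside \<open>Y\<close>, the only place where colours are not controlled.\<close>

lemma gadget_clique_cross:
  assumes "mono_clique c b X" "mono_cross c b X Y" "finite Y" "X \<inter> Y = {}"
    "card X = 2 * t" "card Y = t"
  shows "gadget c b (X \<union> Y) (3 * t)"
  unfolding gadget_def
proof (intro conjI allI impI)
  have finX: "finite X" using assms by (simp add: mono_clique_def)
  then show "finite (X \<union> Y)" using assms by simp
  fix S :: "nat set" and E assume A: "deg2_graph S E \<and> card S = card (X \<union> Y)"
  then have G: "deg2_graph S E" by simp
  have cS: "card S = 3 * t" using A finX assms by (simp add: card_Un_disjoint)
  obtain \<sigma> I where \<sigma>: "bij_betw \<sigma> S (X \<union> Y)" "I \<subseteq> S" "card I = t" "\<forall>e\<in>E. \<not> e \<subseteq> I"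
    "\<sigma> ` I \<subseteq> Y" "\<sigma> ` (S - I) \<subseteq> X"
    using independent_placement[OF G cS finX assms(3-6)] by metis
  have "c (\<sigma> ` e) = b" if e: "e \<in> E" for e
  proof -
    obtain u where u: "u \<in> e" "u \<notin> I" using \<sigma>(4) e by blast
    obtain v where uv: "e = {u, v}" "u \<noteq> v"
      using deg2_graph_edge[OF G e] u by (auto simp: card_2_iff)
    have S: "u \<in> S" "v \<in> S" using deg2_graph_edge[OF G e] uv by auto
    have uX: "\<sigma> u \<in> X" using \<sigma>(6) S u by auto
    have ne: "\<sigma> u \<noteq> \<sigma> v" using \<sigma>(1) S uv by (auto simp: bij_betw_def inj_on_def)
    have "\<sigma> v \<in> X \<or> \<sigma> v \<in> Y" using \<sigma>(5,6) S by auto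
    then show ?thesis using uX ne assms(1,2) uv by (auto simp: mono_clique_def mono_cross_def)
  qed
  then have "{e\<in>E. c (\<sigma> ` e) = b} = E" by auto
  moreover have "card E \<le> card S" using G deg2_graph_card_edges by blast
  ultimately show "\<exists>\<sigma>. bij_betw \<sigma> S (X \<union> Y) \<and> real (card {e\<in>E. c (\<sigma> ` e) = b})
      \<ge> real (3 * t) - (2 * real (card S) - 2 * real (card E))"
    using \<sigma>(1) cS by (intro exI[of _ \<sigma>]) auto
qed

text \<open>Each edge meeting the independent set placed in \<open>Y\<close> goes across to
  \<open>X\<close>, so it is enough to count these edges: their number is the degree sum of that
  set, which is \<open>2 * t\<close> minus at most the total deficit.\<close>

lemma gadget_cross:
  assumes "mono_cross c b X Y" "finite X" "finite Y" "X \<inter> Y = {}"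
    "card X = 2 * t" "card Y = t"
  shows "gadget c b (X \<union> Y) (2 * t)"
  unfolding gadget_def
proof (intro conjI allI impI)
  show "finite (X \<union> Y)" using assms by simp
  fix S :: "nat set" and E assume A: "deg2_graph S E \<and> card S = card (X \<union> Y)"
  then have G: "deg2_graph S E" by simp
  note fin = deg2_graph_finite[OF G]
  have cS: "card S = 3 * t" using A assms by (simp add: card_Un_disjoint)
  obtain \<sigma> I where \<sigma>: "bij_betw \<sigma> S (X \<union> Y)" "I \<subseteq> S" "card I = t" "\<forall>e\<in>E. \<not> e \<subseteq> I"
    "\<sigma> ` I \<subseteq> Y" "\<sigma> ` (S - I) \<subseteq> X"
    using independent_placement[OF G cS assms(2-6)] by metis
  have finI: "finite I" using \<sigma>(2) fin(1) by (rule finite_subset)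
  define D where "D = {e\<in>E. e \<inter> I \<noteq> {}}"
  have col: "c (\<sigma> ` e) = b" if e: "e \<in> D" for e
  proof -
    have eE: "e \<in> E" using e by (simp add: D_def)
    obtain u where u: "u \<in> e" "u \<notin> I" using \<sigma>(4) eE by blast
    obtain v where v: "v \<in> e" "v \<in> I" using e by (auto simp: D_def)
    have uv: "e = {u, v}"
      using deg2_graph_edge[OF G eE] u v by (auto simp: card_2_iff)
    have "u \<in> S" using deg2_graph_edge[OF G eE] u by auto
    then have "\<sigma> u \<in> X" "\<sigma> v \<in> Y" using \<sigma>(5,6) u v by auto
    then show ?thesis using assms(1) uv by (auto simp: mono_cross_def)
  qed
  \<comment> \<open>Double counting: by independence an edge of \<open>D\<close> has exactly one
    endpoint in \<open>I\<close>.\<close>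
  have "(\<Sum>v\<in>I. card {e\<in>E. v \<in> e}) = (\<Sum>v\<in>I. card {e\<in>D. v \<in> e})"
    by (intro sum.cong arg_cong[of _ _ card]) (auto simp: D_def)
  also have "\<dots> = 1 * card D"
  proof (rule sum_multicount[OF finI])
    show "finite D" using fin by (simp add: D_def)
    show "\<forall>e\<in>D. card {v \<in> I. v \<in> e} = 1"
    proof
      fix e assume "e \<in> D"
      then have eE: "e \<in> E" and "e \<inter> I \<noteq> {}" by (auto simp: D_def)
      then have "card (e \<inter> I) \<noteq> 0" using finI by auto
      moreover have "card (e \<inter> I) < card e"
        using \<sigma>(4) eE deg2_graph_edge[OF G eE] fin
        by (intro psubset_card_mono) (auto intro: finite_subset)
      ultimately have "card (e \<inter> I) = 1" using deg2_graph_edge[OF G eE] by auto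
      moreover have "{v \<in> I. v \<in> e} = e \<inter> I" by auto
      ultimately show "card {v \<in> I. v \<in> e} = 1" by simp
    qed
  qed
  finally have D: "(\<Sum>v\<in>I. card {e\<in>E. v \<in> e}) = card D" by simp
  have "2 * card E = (\<Sum>v\<in>S. card {e\<in>E. v \<in> e})" using deg2_graph_sum_degrees[OF G] by simp
  also have "\<dots> = (\<Sum>v\<in>S - I. card {e\<in>E. v \<in> e}) + (\<Sum>v\<in>I. card {e\<in>E. v \<in> e})"
    using \<sigma>(2) fin by (intro sum.subset_diff) auto
  \<comment> \<open>Outside \<open>I\<close> degrees are at most 2, so what is missing from the
    degree sum of \<open>I\<close> is charged to the deficit of the whole graph.\<close>
  also have "(\<Sum>v\<in>S - I. card {e\<in>E. v \<in> e}) \<le> (\<Sum>v\<in>S - I. 2)"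
    using G by (intro sum_mono) (auto simp: deg2_graph_def)
  also have "\<dots> = 2 * card S - 2 * t" using \<sigma> finI by (simp add: card_Diff_subset)
  finally have le: "2 * card E \<le> 2 * card S - 2 * t + card D" using D by simp
  have "card D \<le> card {e\<in>E. c (\<sigma> ` e) = b}"
    using col fin by (intro card_mono) (auto simp: D_def)
  then have "real (card {e\<in>E. c (\<sigma> ` e) = b})
      \<ge> real (2 * t) - (2 * real (card S) - 2 * real (card E))"
    using le cS by linarith
  then show "\<exists>\<sigma>. bij_betw \<sigma> S (X \<union> Y) \<and> real (card {e\<in>E. c (\<sigma> ` e) = b})
      \<ge> real (2 * t) - (2 * real (card S) - 2 * real (card E))"
    using \<sigma>(1) by (intro exI[of _ \<sigma>] conjI)
qed

section \<open>Guarantees for both colours together\<close>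

text \<open>Only the sum is recorded: its split between the colours varies from chunk to chunk,
  while the sum is additive up to a constant and one colour finally gets at least half of
  it.\<close>

definition balanced :: "(nat set \<Rightarrow> bool) \<Rightarrow> nat set \<Rightarrow> real \<Rightarrow> bool" where
  "balanced c X \<sigma> \<longleftrightarrow>
     (\<exists>\<rho> \<beta>. gadget c True X \<rho> \<and> gadget c False X \<beta> \<and> \<sigma> \<le> \<rho> + \<beta>)"

lemma gadgets_both:
  assumes "gadget c b X \<rho>" "gadget c (\<not> b) X \<beta>" "\<sigma> \<le> \<rho> + \<beta>"
  shows "balanced c X \<sigma>"
proof (cases b)
  case True
  then show ?thesis using assms unfolding balanced_def by auto
next
  case False
  then show ?thesis using assms unfolding balanced_def
    by (intro exI[of _ \<beta>] exI[of _ \<rho>]) auto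
qed

lemma balanced_mono: "balanced c X \<sigma> \<Longrightarrow> \<sigma>' \<le> \<sigma> \<Longrightarrow> balanced c X \<sigma>'"
  unfolding balanced_def by (meson order.trans)

lemma balanced_0: "finite X \<Longrightarrow> balanced c X 0"
  by (rule gadgets_both[of c True X 0 0]) (auto intro: gadget_0)

text \<open>The loss of 4 from \<open>gadget_Un\<close> occurs once for each colour.\<close>

lemma balanced_Un:
  assumes "balanced c X \<sigma>" "balanced c Y \<upsilon>" "X \<inter> Y = {}"
  shows "balanced c (X \<union> Y) (\<sigma> + \<upsilon> - 8)"
proof -
  obtain \<rho> \<beta> where 1: "gadget c True X \<rho>" "gadget c False X \<beta>" "\<sigma> \<le> \<rho> + \<beta>"
    using assms(1) unfolding balanced_def by auto
  obtain \<rho>' \<beta>' where 2: "gadget c True Y \<rho>'" "gadget c False Y \<beta>'" "\<upsilon> \<le> \<rho>' + \<beta>'"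
    using assms(2) unfolding balanced_def by auto
  show ?thesis
    using gadget_Un[OF 1(1) 2(1) assms(3)] gadget_Un[OF 1(2) 2(2) assms(3)] 1(3) 2(3)
    by (intro gadgets_both[of c True _ "\<rho> + \<rho>' - 4" "\<beta> + \<beta>' - 4"]) auto
qed

text \<open>If the cross edges share the colour of \<open>X\<close>, the guarantees are
  \<open>3 * t\<close> and \<open>t - 4\<close>; otherwise they are \<open>2 * t\<close> and
  \<open>2 * t - 4\<close>.\<close>

lemma balanced_chunk:
  assumes "mono_clique c b X" "mono_clique c (\<not> b) Y" "mono_cross c d X Y" "X \<inter> Y = {}"
    "card X = 2 * t" "card Y = t"
  shows "balanced c (X \<union> Y) (4 * real t - 4)"
proof -
  have fin: "finite X" "finite Y" using assms by (auto simp: mono_clique_def)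
  show ?thesis
  proof (cases "d = b")
    case True
    have "gadget c b (X \<union> Y) (3 * t)"
      using gadget_clique_cross[OF assms(1) _ fin(2) assms(4-6)] assms(3) True by simp
    moreover have "gadget c (\<not> b) (X \<union> Y) (0 + real (card Y) - 4)"
      by (rule gadget_Un[OF gadget_0[OF fin(1)] gadget_mono_clique[OF assms(2)] assms(4)])
    ultimately show ?thesis using assms(6) by (auto intro: gadgets_both)
  next
    case False
    then have "d = (\<not> b)" by auto
    then have "gadget c (\<not> b) (X \<union> Y) (2 * t)"
      using gadget_cross[OF _ fin assms(4-6)] assms(3) by simp
    moreover have "gadget c b (X \<union> Y) (real (card X) + 0 - 4)"
      by (rule gadget_Un[OF gadget_mono_clique[OF assms(1)] gadget_0[OF fin(2)] assms(4)])
    ultimately show ?thesis using assms(5) by (auto intro: gadgets_both)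
  qed
qed

text \<open>Vertices of \<open>X\<close> are classified by their True-neighbourhood in a set
  \<open>Z\<close> of \<open>2 * t\<close> vertices. There are \<open>2 ^ (2 * t)\<close> classes,
  so one has \<open>2 * t\<close> members, and their common neighbourhood or its complement in
  \<open>Z\<close> has at least \<open>t\<close> vertices.\<close>

lemma bipartite_pigeonhole:
  assumes "finite X" "finite Y" "2 * t * 2 ^ (2 * t) \<le> card X" "2 * t \<le> card Y"
  shows "\<exists>X'\<subseteq>X. \<exists>Y'\<subseteq>Y. \<exists>b. card X' = 2 * t \<and> card Y' = t \<and> mono_cross c b X' Y'"
proof -
  obtain Z where Z: "Z \<subseteq> Y" "card Z = 2 * t" "finite Z"
    using obtain_subset_with_card_n[OF assms(4)] by metis
  define f where "f x = {y\<in>Z. c {x, y}}" for x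
  have "\<exists>P\<in>Pow Z. card (f -` {P} \<inter> X) * card (Pow Z) \<ge> card X"
    by (rule pigeonhole_card) (use assms Z in \<open>auto simp: f_def\<close>)
  then obtain P where P: "P \<subseteq> Z" "card (f -` {P} \<inter> X) * 2 ^ (2 * t) \<ge> card X"
    using Z by (auto simp: card_Pow)
  then have "2 * t * 2 ^ (2 * t) \<le> card (f -` {P} \<inter> X) * 2 ^ (2 * t)"
    using assms(3) by linarith
  then have "2 * t \<le> card (f -` {P} \<inter> X)" by simp
  then obtain X' where X': "X' \<subseteq> f -` {P} \<inter> X" "card X' = 2 * t"
    using obtain_subset_with_card_n by metis
  then have f: "f x = P" if "x \<in> X'" for x using that by auto
  have "card P + card (Z - P) = 2 * t"
    using P(1) Z by (metis card_Diff_subset card_mono finite_subset le_add_diff_inverse)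
  then consider "t \<le> card P" | "t \<le> card (Z - P)" by linarith
  then show ?thesis
  proof cases
    case 1
    then obtain Y' where Y': "Y' \<subseteq> P" "card Y' = t" using obtain_subset_with_card_n by metis
    have "mono_cross c True X' Y'" using f Y' by (auto simp: mono_cross_def f_def)
    moreover have "X' \<subseteq> X" "Y' \<subseteq> Y" using X' Y' P Z by auto
    ultimately show ?thesis using X'(2) Y'(2) by blast
  next
    case 2
    then obtain Y' where Y': "Y' \<subseteq> Z - P" "card Y' = t" using obtain_subset_with_card_n by metis
    have "mono_cross c False X' Y'" using f Y' Z by (auto simp: mono_cross_def f_def)
    moreover have "X' \<subseteq> X" "Y' \<subseteq> Y" using X' Y' Z by auto
    ultimately show ?thesis using X'(2) Y'(2) by blast
  qed
qed

section \<open>Greedy decomposition of sets in which every large subset contains a clique\<close>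

text \<open>Quantifying over all large subsets makes the property hereditary, so cliques can be
  removed one by one until fewer than \<open>N\<close> vertices remain.\<close>

definition clique_rich :: "(nat set \<Rightarrow> bool) \<Rightarrow> bool \<Rightarrow> nat set \<Rightarrow> nat \<Rightarrow> nat \<Rightarrow> bool" where
  "clique_rich c b A N m \<longleftrightarrow> finite A \<and>
     (\<forall>Z\<subseteq>A. N \<le> card Z \<longrightarrow> (\<exists>W\<subseteq>Z. card W = m \<and> mono_clique c b W))"

lemma clique_rich_finite: "clique_rich c b A N m \<Longrightarrow> finite A"
  by (simp add: clique_rich_def)

lemma clique_rich_subset: "clique_rich c b A N m \<Longrightarrow> B \<subseteq> A \<Longrightarrow> clique_rich c b B N m"
  unfolding clique_rich_def using finite_subset by (meson order.trans)

lemma clique_rich_obtain: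
  assumes "clique_rich c b A N m" "N \<le> card A"
  obtains W where "W \<subseteq> A" "card W = m" "mono_clique c b W" "finite W"
  using assms unfolding clique_rich_def mono_clique_def by (meson order.refl)

text \<open>Each removed clique contributes \<open>m - 4\<close>, a fraction
  \<open>1 - 4 / m\<close> of its vertices; the fewer than \<open>N\<close> vertices left over
  contribute nothing.\<close>

lemma gadget_clique_rich:
  assumes "clique_rich c b A N m" "4 \<le> m"
  shows "gadget c b A ((1 - 4 / m) * (real (card A) - N))"
  using assms(1)
proof (induction "card A" arbitrary: A rule: less_induct)
  case less
  note fin = clique_rich_finite[OF less.prems]
  have m: "0 \<le> 1 - 4 / real m" using assms(2) by simp
  show ?case
  proof (cases "N \<le> card A")
    case False
    then have "(1 - 4 / real m) * (real (card A) - N) \<le> 0"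
      using m by (intro mult_nonneg_nonpos) auto
    then show ?thesis by (rule gadget_mono[OF gadget_0[OF fin]])
  next
    case True
    obtain W where W: "W \<subseteq> A" "card W = m" "mono_clique c b W" "finite W"
      using clique_rich_obtain[OF less.prems True] by metis
    have le: "m \<le> card A" using W fin card_mono by blast
    have cD: "card (A - W) = card A - m" using W by (simp add: card_Diff_subset)
    have "gadget c b (A - W) ((1 - 4 / m) * (real (card (A - W)) - N))"
      using le cD assms(2) by (intro less.hyps clique_rich_subset[OF less.prems]) auto
    then have "gadget c b (W \<union> (A - W)) (card W + (1 - 4 / m) * (real (card (A - W)) - N) - 4)"
      by (intro gadget_Un gadget_mono_clique W) auto
    moreover have "W \<union> (A - W) = A" using W by auto
    moreover have "card W + (1 - 4 / m) * (real (card (A - W)) - N) - 4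
        = (1 - 4 / m) * (real (card A) - N)"
      using le cD W(2) assms(2) by (simp add: of_nat_diff field_simps)
    ultimately show ?thesis by simp
  qed
qed

text \<open>Chunks take \<open>2 * t\<close> vertices from the larger side and \<open>t\<close> from
  the smaller, which keeps the sizes within a factor 2 up to \<open>t\<close>. Each chunk of
  \<open>3 * t\<close> vertices yields \<open>4 * t - 4\<close>, less 8 for the union.\<close>

lemma balanced_clique_rich:
  assumes "clique_rich c b A N m" "clique_rich c (\<not> b) B N m" "A \<inter> B = {}"
    "2 * t * 2 ^ (2 * t) \<le> m" "3 \<le> t"
    "card A \<le> 2 * card B + t" "card B \<le> 2 * card A + t"
  shows "balanced c (A \<union> B)
    ((4 * real t - 12) / (3 * t) * (real (card A) + card B - 3 * N - t))"
  using assms(1-3,6,7)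
proof (induction "card A + card B" arbitrary: A B b rule: less_induct)
  case less
  define \<alpha> where "\<alpha> = (4 * real t - 12) / (3 * t)"
  have \<alpha>0: "0 \<le> \<alpha>" using assms(5) by (simp add: \<alpha>_def)
  have m: "2 * t \<le> m"
    using assms(4) by (rule order.trans[rotated]) simp
  \<comment> \<open>One round, with the sides ordered by size. The colour \<open>d\<close> of the
    larger side is free because the larger side may change between rounds.\<close>
  have step: "balanced c (A' \<union> B') (\<alpha> * (real (card A') + card B' - 3 * N - t))"
    if *: "clique_rich c d A' N m" "clique_rich c (\<not> d) B' N m" "A' \<inter> B' = {}"
      "card A' \<le> 2 * card B' + t" "card A' + card B' = card A + card B" "card B' \<le> card A'"
    for A' B' d
  proof (cases "N \<le> card B'")
    case False
    \<comment> \<open>Once the smaller side is below \<open>N\<close>, the size condition leaves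
      fewer than \<open>3 * N + t\<close> vertices in all, so the claimed bound is trivial.\<close>
    have "real (card A') + card B' - 3 * N - t \<le> 0" using False *(4) by linarith
    then have "\<alpha> * (real (card A') + card B' - 3 * N - t) \<le> 0"
      using \<alpha>0 by (intro mult_nonneg_nonpos) auto
    moreover have "balanced c (A' \<union> B') 0"
      using clique_rich_finite[OF *(1)] clique_rich_finite[OF *(2)] by (intro balanced_0) auto
    ultimately show ?thesis using balanced_mono by blast
  next
    case True
    obtain V where V: "V \<subseteq> A'" "card V = m" "mono_clique c d V" "finite V"
      using clique_rich_obtain[OF *(1) order.trans[OF True *(6)]] by metis
    obtain W where W: "W \<subseteq> B'" "card W = m" "mono_clique c (\<not> d) W" "finite W"
      using clique_rich_obtain[OF *(2) True] by metis
    obtain X Y e where XY: "X \<subseteq> V" "Y \<subseteq> W" "card X = 2 * t" "card Y = t" "mono_cross c e X Y"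
      using bipartite_pigeonhole[of V W t c] V W assms(4) m by auto
    have fin: "finite X" "finite Y" "finite A'" "finite B'"
      using XY V W clique_rich_finite[OF *(1)] clique_rich_finite[OF *(2)] finite_subset by auto
    have sub: "X \<subseteq> A'" "Y \<subseteq> B'" using XY V W by auto
    have bal: "balanced c (X \<union> Y) (4 * real t - 4)"
      by (rule balanced_chunk[OF mono_clique_subset[OF V(3) XY(1)]
            mono_clique_subset[OF W(3) XY(2)] XY(5) _ XY(3,4)]) (use sub *(3) in auto)
    have le: "2 * t \<le> card A'" "t \<le> card B'" using card_mono[OF fin(3) sub(1)]
        card_mono[OF fin(4) sub(2)] XY by auto
    have cA: "card (A' - X) = card A' - 2 * t" and cB: "card (B' - Y) = card B' - t"
      using sub fin XY by (auto simp: card_Diff_subset)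
    have rest: "balanced c ((A' - X) \<union> (B' - Y))
        (\<alpha> * (real (card (A' - X)) + card (B' - Y) - 3 * N - t))"
      unfolding \<alpha>_def
    proof (rule less.hyps[of _ _ d])
      show "card (A' - X) + card (B' - Y) < card A + card B"
        using cA cB le *(5) assms(5) by linarith
      show "card (A' - X) \<le> 2 * card (B' - Y) + t" using cA cB le *(4) by linarith
      show "card (B' - Y) \<le> 2 * card (A' - X) + t" using cA cB le *(6) by linarith
    qed (use *(3) clique_rich_subset[OF *(1)] clique_rich_subset[OF *(2)] in auto)
    have "balanced c ((X \<union> Y) \<union> ((A' - X) \<union> (B' - Y)))
        (4 * real t - 4 + \<alpha> * (real (card (A' - X)) + card (B' - Y) - 3 * N - t) - 8)"
      using bal rest by (rule balanced_Un) (use sub *(3) in auto)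
    moreover have "(X \<union> Y) \<union> ((A' - X) \<union> (B' - Y)) = A' \<union> B'" using sub by auto
    moreover have "4 * real t - 4 + \<alpha> * (real (card (A' - X)) + card (B' - Y) - 3 * N - t) - 8
        = \<alpha> * (real (card A') + card B' - 3 * N - t)"
    proof -
      have "\<alpha> * (3 * real t) = 4 * real t - 12" using assms(5) by (simp add: \<alpha>_def)
      moreover have "real (card (A' - X)) + card (B' - Y) - 3 * N - t
          = (real (card A') + card B' - 3 * N - t) - 3 * real t"
        using cA cB le by (simp add: of_nat_diff)
      ultimately show ?thesis by (simp only: right_diff_distrib)
    qed
    ultimately show ?thesis by simp
  qed
  show ?case unfolding \<alpha>_def[symmetric]
  proof (cases "card B \<le> card A")
    case True
    then show "balanced c (A \<union> B) (\<alpha> * (real (card A) + card B - 3 * N - t))"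
      by (intro step[OF less.prems(1-4)]) auto
  next
    case False
    have "balanced c (B \<union> A) (\<alpha> * (real (card B) + card A - 3 * N - t))"
      by (rule step[OF less.prems(2)]) (use less.prems False in auto)
    then show "balanced c (A \<union> B) (\<alpha> * (real (card A) + card B - 3 * N - t))"
      by (simp add: Un_commute add.commute)
  qed
qed

section \<open>Cliques covering most vertices\<close>

text \<open>A union of disjoint cliques of size \<open>m * q\<close>: by averaging, a subset of relative density above
  \<open>1 / q\<close> meets one of them in \<open>m\<close> vertices.\<close>
lemma clique_exhaustion:
  fixes c :: "nat set \<Rightarrow> bool"
  assumes "finite V" "0 < m" "0 < q"
  shows "\<exists>A\<subseteq>V. (\<forall>Z\<subseteq>A. card A < q * card Z \<longrightarrow> (\<exists>W\<subseteq>Z. card W = m \<and> mono_clique c b W)) \<and>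
     \<not> (\<exists>W\<subseteq>V - A. card W = m * q \<and> mono_clique c b W)"
  using assms(1)
proof (induction "card V" arbitrary: V rule: less_induct)
  case less
  show ?case
  proof (cases "\<exists>W\<subseteq>V. card W = m * q \<and> mono_clique c b W")
    case False
    then show ?thesis by (intro exI[of _ "{}"]) auto
  next
    case True
    then obtain X where X: "X \<subseteq> V" "card X = m * q" "mono_clique c b X" by auto
    have finX: "finite X" using X(1) less.prems by (rule finite_subset)
    have "0 < m * q" using assms by simp
    then have "X \<noteq> {}" using X(2) by auto
    then have "card (V - X) < card V" using X(1) less.prems by (intro psubset_card_mono) auto
    from less.hyps[OF this] less.prems obtain A where A: "A \<subseteq> V - X"
      "\<And>Z. Z \<subseteq> A \<Longrightarrow> card A < q * card Z \<Longrightarrow> \<exists>W\<subseteq>Z. card W = m \<and> mono_clique c b W"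
      "\<not> (\<exists>W\<subseteq>V - X - A. card W = m * q \<and> mono_clique c b W)" by auto
    have finA: "finite A" using A(1) less.prems by (meson finite_Diff finite_subset)
    have cU: "card (A \<union> X) = card A + m * q"
      using A(1) finA finX X(2) by (subst card_Un_disjoint) auto
    have "\<exists>W\<subseteq>Z. card W = m \<and> mono_clique c b W"
      if Z: "Z \<subseteq> A \<union> X" "card (A \<union> X) < q * card Z" for Z
    proof (cases "m \<le> card (Z \<inter> X)")
      case True
      then obtain W where "W \<subseteq> Z \<inter> X" "card W = m" using obtain_subset_with_card_n by metis
      then show ?thesis using mono_clique_subset[OF X(3), of W] by auto
    next
      case False
      have finZ: "finite Z" using Z(1) finA finX by (meson finite_UnI finite_subset)
      have "Z = (Z \<inter> A) \<union> (Z \<inter> X)" using Z(1) by auto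
      then have "card Z \<le> card (Z \<inter> A) + card (Z \<inter> X)" using card_Un_le by metis
      then have "q * card Z \<le> q * card (Z \<inter> A) + q * card (Z \<inter> X)"
        by (metis distrib_left mult_le_mono2)
      moreover have "q * card (Z \<inter> X) \<le> m * q" using False by simp
      \<comment> \<open>Leaving out \<open>X\<close> lowers the right side by at most
        \<open>m * q\<close> and the left side by exactly that, so the density condition passes to
        \<open>A\<close>.\<close>
      ultimately have "card A < q * card (Z \<inter> A)" using Z(2) cU by linarith
      then obtain W where "W \<subseteq> Z \<inter> A" "card W = m" "mono_clique c b W" using A(2) by blast
      then show ?thesis by auto
    qed
    moreover have "V - X - A = V - (A \<union> X)" by auto
    ultimately show ?thesis using A X(1)
      by (intro exI[of _ "A \<union> X"]) auto
  qed
qed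

text \<open>Ramsey's theorem for the graph of True edges. The two sizes differ because it is applied
  where True cliques of the larger size \<open>m * q\<close> have been exhausted.\<close>

lemma ramsey_colouring:
  "\<exists>R. \<forall>(c :: nat set \<Rightarrow> bool) V. finite V \<and> R \<le> card V \<longrightarrow>
     (\<exists>W\<subseteq>V. card W = k \<and> mono_clique c True W \<or> card W = m \<and> mono_clique c False W)"
proof -
  obtain R where R: "\<And>(V::nat set) E. finite V \<and> card V \<ge> R \<Longrightarrow>
      \<exists>W\<subseteq>V. card W = k \<and> clique W E \<or> card W = m \<and> indep W E"
    using ramsey2[where 'a=nat] by blast
  have "\<exists>W\<subseteq>V. card W = k \<and> mono_clique c True W \<or> card W = m \<and> mono_clique c False W"
    if V: "finite V \<and> R \<le> card V" for c V
  proof -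
    obtain W where W: "W \<subseteq> V" "card W = k \<and> clique W {e. c e} \<or> card W = m \<and> indep W {e. c e}"
      using R[OF V] by blast
    have "finite W" using W(1) V finite_subset by auto
    then show ?thesis using W
      by (intro exI[of _ W]) (auto simp: clique_def indep_def mono_clique_def)
  qed
  then show ?thesis by blast
qed

section \<open>Two-factors and the final estimate\<close>

lemma two_factor_deg2_graph:
  assumes "two_factor n F"
  shows "deg2_graph {..<n} F" "card F = n"
proof -
  show G: "deg2_graph {..<n} F"
    using assms by (auto simp: two_factor_def edges_Kn_def deg2_graph_def)
  have "2 * card F = (\<Sum>v<n. card {e\<in>F. v \<in> e})" using deg2_graph_sum_degrees[OF G] by simp
  also have "\<dots> = (\<Sum>v<n. 2)" using assms by (intro sum.cong) (auto simp: two_factor_def)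
  finally show "card F = n" by simp
qed

text \<open>A 2-factor has as many edges as vertices, so the deficit term vanishes.\<close>

lemma gadget_two_factor_copy:
  assumes "gadget c b {..<n} \<tau>" "two_factor n F"
  shows "\<exists>H. is_copy n F H \<and> real (card {e\<in>H. c e = b}) \<ge> \<tau>"
proof -
  note G = two_factor_deg2_graph[OF assms(2)]
  obtain \<sigma> where \<sigma>: "bij_betw \<sigma> {..<n} {..<n}"
    "real (card {e\<in>F. c (\<sigma> ` e) = b}) \<ge> \<tau>"
    using assms(1) G unfolding gadget_def by fastforce
  define H where "H = (\<lambda>e. \<sigma> ` e) ` F"
  have "F \<subseteq> Pow {..<n}" using deg2_graph_edge(1)[OF G(1)] by auto
  then have inj: "inj_on (image \<sigma>) F"
    using \<sigma>(1) inj_on_image_Pow inj_on_subset unfolding bij_betw_def by metis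
  have "{e\<in>H. c e = b} = image \<sigma> ` {e\<in>F. c (\<sigma> ` e) = b}" unfolding H_def by auto
  moreover have "inj_on (image \<sigma>) {e\<in>F. c (\<sigma> ` e) = b}" using inj by (rule inj_on_subset) auto
  ultimately have "card {e\<in>H. c e = b} = card {e\<in>F. c (\<sigma> ` e) = b}"
    by (simp add: card_image)
  then show ?thesis using \<sigma> unfolding is_copy_def H_def by auto
qed

text \<open>True cliques are exhausted into \<open>A\<close>; by Ramsey the rest \<open>B\<close> is
  rich in False cliques. Either one side has at least two thirds of the vertices, or both sides are
  cut into chunks. The constant \<open>C\<close> depends on \<open>q\<close> alone.\<close>

lemma monochromatic_gadget:
  assumes "3 \<le> q"
  shows "\<exists>C. \<forall>n c. \<exists>b. gadget c b {..<n} (2 / 3 * real n - 5 * (real n / real q) - C)"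
proof -
  \<comment> \<open>The clique size that \<open>bipartite_pigeonhole\<close> demands for
    \<open>t = q\<close>.\<close>
  define m where "m = 2 * q * 2 ^ (2 * q)"
  have qm: "2 * q \<le> m" unfolding m_def by simp
  then have m: "4 \<le> m" "0 < m" using assms by auto
  obtain R where R: "\<And>c V. finite V \<Longrightarrow> R \<le> card V \<Longrightarrow>
      \<exists>W\<subseteq>V. card W = m * q \<and> mono_clique c True W \<or> card W = m \<and> mono_clique c False W"
    using ramsey_colouring[of "m * q" m] by metis
  \<comment> \<open>Large enough for both cases: a dominant side needs \<open>R + 5\<close>, and
    chunks need \<open>2 * R + 2 + 2 * q / 3\<close> after halving.\<close>
  define C where "C = 2 * real R + real q + 6"
  have "\<exists>b. gadget c b {..<n} (2 / 3 * real n - 5 * (real n / real q) - C)"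
    for n and c :: "nat set \<Rightarrow> bool"
  proof -
    define x where "x = real n / real q"
    define y where "y = 2 / 3 * real n - 5 * (real n / real q) - C"
    \<comment> \<open>At least \<open>R\<close> for Ramsey in \<open>B\<close>, and strictly above
      \<open>n / q\<close> for the density condition in \<open>A\<close>.\<close>
    define N where "N = R + n div q + 1"
    have N: "real N \<le> real R + real n / real q + 1"
      unfolding N_def using of_nat_div_le_of_nat[of n q, where 'a=real] by simp
    obtain A where A: "A \<subseteq> {..<n}"
      "\<And>Z. Z \<subseteq> A \<Longrightarrow> card A < q * card Z \<Longrightarrow> \<exists>W\<subseteq>Z. card W = m \<and> mono_clique c True W"
      "\<not> (\<exists>W\<subseteq>{..<n} - A. card W = m * q \<and> mono_clique c True W)"
      using clique_exhaustion[of "{..<n}" m q c True] m(2) assms by auto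
    define B where "B = {..<n} - A"
    have fin: "finite A" "finite B" unfolding B_def using A(1) finite_subset by auto
    have AB: "A \<inter> B = {}" "A \<union> B = {..<n}" unfolding B_def using A(1) by auto
    have cAB: "card A + card B = n"
      using card_Un_disjoint[OF fin AB(1)] AB(2) by simp
    have richA: "clique_rich c True A N m"
      unfolding clique_rich_def
    proof (intro conjI allI impI fin)
      fix Z assume Z: "Z \<subseteq> A" "N \<le> card Z"
      have "n < q * (n div q + 1)"
        using assms by (metis add.commute dividend_less_times_div mult.commute mult_Suc_right
            plus_1_eq_Suc less_le_trans zero_less_numeral)
      also have "\<dots> \<le> q * card Z" using Z(2) unfolding N_def by (intro mult_le_mono2) simp
      finally show "\<exists>W\<subseteq>Z. card W = m \<and> mono_clique c True W"
        using A(2) Z(1) cAB by auto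
    qed
    have richB: "clique_rich c False B N m"
      unfolding clique_rich_def
    proof (intro conjI allI impI fin)
      fix Z assume Z: "Z \<subseteq> B" "N \<le> card Z"
      have "finite Z" using Z(1) fin(2) by (rule finite_subset)
      then obtain W where "W \<subseteq> Z"
        "card W = m * q \<and> mono_clique c True W \<or> card W = m \<and> mono_clique c False W"
        using R[of Z c] Z(2) unfolding N_def by auto
      then show "\<exists>W\<subseteq>Z. card W = m \<and> mono_clique c False W"
        using A(3) Z(1) unfolding B_def by auto
    qed
    \<comment> \<open>The dominant side alone is filled with cliques. Of the
      \<open>5 * (n / q)\<close>, four parts pay for the unions and one for the bound on
      \<open>N\<close>.\<close>
    have large: "gadget c b {..<n} (2 / 3 * real n - 5 * (real n / real q) - C)"
      if *: "clique_rich c b X N m" "X \<inter> Y = {}" "X \<union> Y = {..<n}" "finite Y"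
        "card X + card Y = n" "2 * card Y \<le> card X" for b X Y
    proof (rule gadget_mono)
      show "gadget c b {..<n} ((1 - 4 / m) * (real (card X) - N) + 0 - 4)"
        using gadget_Un[OF gadget_clique_rich[OF *(1) m(1)] gadget_0[OF *(4)] *(2)] *(3) by simp
      have "4 / real m * (real (card X) - N) \<le> 4 / real m * real n"
        using *(5) by (intro mult_left_mono) auto
      also have "\<dots> \<le> 4 / real q * real n"
        using qm assms by (intro mult_right_mono divide_left_mono) auto
      finally have "4 / real m * (real (card X) - N) \<le> 4 * (real n / real q)" by simp
      moreover have "2 / 3 * real n \<le> real (card X)" using *(5,6) by linarith
      ultimately show "2 / 3 * real n - 5 * (real n / real q) - C
          \<le> (1 - 4 / m) * (real (card X) - N) + 0 - 4"
        using N of_nat_0_le_iff[of R, where 'a=real] of_nat_0_le_iff[of q, where 'a=real]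
        unfolding C_def left_diff_distrib[of 1] mult_1 by linarith
    qed
    consider "2 * card B \<le> card A" | "2 * card A \<le> card B"
      | "card A \<le> 2 * card B" "card B \<le> 2 * card A" by linarith
    then show ?thesis
    proof cases
      case 1
      then show ?thesis using large[OF richA AB fin(2) cAB] by blast
    next
      case 2
      then show ?thesis using large[OF richB _ _ fin(1)] AB cAB
        by (metis Int_commute Un_commute add.commute)
    next
      case 3
      define s where "s = (4 * real q - 12) / (3 * q) * (real n - 3 * N - q)"
      have "balanced c (A \<union> B) ((4 * real q - 12) / (3 * q) * (real (card A) + card B - 3 * N - q))"
        using richA _ AB(1) _ assms by (rule balanced_clique_rich) (use richB 3 m_def in auto)
      moreover have "real (card A) + card B = n" using cAB by linarith
      ultimately have "balanced c {..<n} s" using AB(2) by (simp add: s_def)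
      then obtain \<rho> \<beta> where g: "gadget c True {..<n} \<rho>" "gadget c False {..<n} \<beta>" "s \<le> \<rho> + \<beta>"
        unfolding balanced_def by auto
      have "s = (4 / 3 - 4 / q) * (real n - 3 * N - q)"
        using assms by (simp add: s_def field_simps)
      also have "\<dots> = 4 / 3 * real n - 4 * (real n / q) - (4 / 3 - 4 / q) * (3 * N + q)"
        by (simp add: algebra_simps)
      finally have "s = 4 / 3 * real n - 4 * (real n / q) - (4 / 3 - 4 / q) * (3 * N + q)" .
      moreover have "(4 / 3 - 4 / real q) * (3 * N + q) \<le> 4 / 3 * (3 * N + q)"
        by (intro mult_right_mono) auto
      ultimately have "4 / 3 * real n - 4 * (real n / real q) - 4 / 3 * (3 * real N + real q) \<le> s"
        by simp
      moreover have "0 \<le> real n / real q" "0 \<le> real q" by simp_all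
      ultimately have "2 * y \<le> s"
        using N unfolding y_def C_def x_def[symmetric] by (simp add: field_simps)
      \<comment> \<open>The better colour has at least half of the sum.\<close>
      then consider "y \<le> \<rho>" | "y \<le> \<beta>" using g(3) by linarith
      then show ?thesis using g(1,2) gadget_mono unfolding y_def by metis
    qed
  qed
  then show ?thesis by blast
qed

theorem theorem1p5:
  fixes \<delta> :: real
  assumes "\<delta> > 0"
  shows "\<exists>n0::nat. \<forall>n\<ge>n0. \<forall>F. two_factor n F \<longrightarrow>
           (\<forall>c :: nat set \<Rightarrow> bool.
              \<exists>H. is_copy n F H \<and>
                 (\<exists>b::bool. real (card {e\<in>H. c e = b}) \<ge> (2/3 - \<delta>) * real n))"
proof -
  \<comment> \<open>This makes \<open>5 * (n / q)\<close> at most \<open>\<delta> * n / 2\<close>;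
    the choice of \<open>n0\<close> absorbs \<open>C\<close> into the other half.\<close>
  obtain q :: nat where q: "max 3 (10 / \<delta>) \<le> real q" using real_arch_simple by blast
  then have q3: "3 \<le> q" by simp
  obtain C where C: "\<And>n c. \<exists>b. gadget c b {..<n} (2 / 3 * real n - 5 * (real n / real q) - C)"
    using monochromatic_gadget[OF q3] by blast
  obtain n0 :: nat where n0: "2 * C / \<delta> \<le> real n0" using real_arch_simple by blast
  have "\<exists>H. is_copy n F H \<and> (\<exists>b. real (card {e\<in>H. c e = b}) \<ge> (2/3 - \<delta>) * real n)"
    if n: "n0 \<le> n" and F: "two_factor n F" for n F and c :: "nat set \<Rightarrow> bool"
  proof -
    obtain b where "gadget c b {..<n} (2 / 3 * real n - 5 * (real n / real q) - C)"
      using C by blast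
    from gadget_two_factor_copy[OF this F] obtain H where H: "is_copy n F H"
      "2 / 3 * real n - 5 * (real n / real q) - C \<le> real (card {e\<in>H. c e = b})" by blast
    have "10 \<le> \<delta> * real q" using q assms by (simp add: field_simps)
    then have "10 * real n \<le> \<delta> * real q * real n" by (intro mult_right_mono) auto
    then have "5 * (real n / real q) \<le> \<delta> * real n / 2" using q3 by (simp add: field_simps)
    moreover have "2 * C / \<delta> \<le> real n" using n0 n by linarith
    then have "C \<le> \<delta> * real n / 2" using assms by (simp add: field_simps)
    ultimately have "(2/3 - \<delta>) * real n \<le> real (card {e\<in>H. c e = b})"
      using H(2) unfolding left_diff_distrib by linarith
    then show ?thesis using H(1) by blast
  qed
  then show ?thesis by blast
qed

end
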